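(* Let $|q|<1$ and $x\in\mathbb{C}$. Then \[ \sum_{n\geq 0} \frac{q^{n^2}(-q;q^2)_n\prod_{i=1}^n(1+2xq^{2i-1}+q^{4i-2})}{(q^2;q^2)_{2n}} =\frac{(-q;q^2)_\infty}{(q^2;q^2)_\infty} \sum_{n\geq 0} q^{2n^2} \big(V_n(x)+V_{n-1}(x)\big). \]
   Context: $(a;q)_n=\prod_{k=0}^{n-1}(1-aq^k)$, $(a;q)_\infty=\prod_{k\ge0}(1-aq^k)$. $V_n(x)$ is the Chebyshev polynomial of the third kind: $V_0=1$, $V_1=2x-1$, $V_n=2xV_{n-1}-V_{n-2}$ ($n>1$), and $V_n=0$ for $n<0$. *)

theory Defs
  imports "HOL-Analysis.Analysis"
begin

definition qpoch :: "complex \<Rightarrow> complex \<Rightarrow> nat \<Rightarrow> complex" where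
  "qpoch a q n = (\<Prod>k<n. 1 - a * q ^ k)"

definition qpoch_inf :: "complex \<Rightarrow> complex \<Rightarrow> complex" where
  "qpoch_inf a q = (\<Prod>k. 1 - a * q ^ k)"

text \<open>The value of \<open>prodinf\<close> in \<open>qpoch_inf\<close> is meaningful because the product converges:\<close>

lemma convergent_prod_qpoch_inf:
  fixes a q :: complex
  assumes "norm q < 1"
  shows "convergent_prod (\<lambda>k. 1 - a * q ^ k)"
proof -
  have "summable (\<lambda>k. norm (1 - a * q ^ k - 1))"
    using assms by (simp add: norm_mult norm_power summable_mult summable_geometric)
  then show ?thesis
    by (intro abs_convergent_prod_imp_convergent_prod)
       (simp add: abs_convergent_prod_conv_summable)
qed

fun chebV_nat :: "nat \<Rightarrow> complex \<Rightarrow> complex" where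
  "chebV_nat 0 x = 1"
| "chebV_nat (Suc 0) x = 2 * x - 1"
| "chebV_nat (Suc (Suc n)) x = 2 * x * chebV_nat (Suc n) x - chebV_nat n x"

definition chebV :: "int \<Rightarrow> complex \<Rightarrow> complex" where
  "chebV n x = (if n < 0 then 0 else chebV_nat (nat n) x)"

end

theory Submission
  imports Defs
begin

text \<open>
  Since \<open>V\<^sub>n + V\<^sub>n\<^sub>-\<^sub>1 = 2 T\<^sub>n\<close> for \<open>n \<ge> 1\<close>, the right-hand series is the bilateral sum of
  \<open>q\<^bsup>2 j\<^sup>2\<^esup> T\<^bsub>|j|\<^esub>(x)\<close>. The finite form of Jacobi's triple product identity, with the powers of
  \<open>z\<close> paired into Chebyshev polynomials of \<open>x = (z + 1/z)/2\<close>, expands the product in the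
  \<open>n\<close>-th summand on the left as a sum over \<open>|j| \<le> n\<close> of
  \<open>q\<^bsup>j\<^sup>2\<^esup> T\<^bsub>|j|\<^esub>(x) / ((q\<^sup>2;q\<^sup>2)\<^bsub>n-j\<^esub> (q\<^sup>2;q\<^sup>2)\<^bsub>n+j\<^esub>)\<close>. After interchanging the sums,
  the inner sum over \<open>n\<close> is a \<open>\<^sub>1\<phi>\<^sub>1\<close> series with the closed form
  \<open>\<^sub>1\<phi>\<^sub>1(a; ab; b) = (b)\<^sub>\<infinity> / (ab)\<^sub>\<infinity>\<close>. The latter follows by iterating
  \<open>(1 - ab) F(b) = (1 - b) F(bQ)\<close>, because \<open>F(bQ\<^sup>n) \<rightarrow> 1\<close>.
\<close>

subsection \<open>q-Pochhammer symbols\<close>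

lemma one_minus_mult_power_nonzero:
  fixes a Q :: complex
  assumes "norm Q < 1" "norm a < 1"
  shows "1 - a * Q ^ n \<noteq> 0"
proof -
  have "norm (a * Q ^ n) \<le> norm a * 1"
    unfolding norm_mult norm_power using assms by (intro mult_left_mono power_le_one) auto
  then have "norm (a * Q ^ n) < 1"
    using assms by simp
  then show ?thesis by auto
qed

lemma qpoch_nonzero:
  assumes "norm Q < 1" "norm a < 1"
  shows "qpoch a Q n \<noteq> 0"
  unfolding qpoch_def using one_minus_mult_power_nonzero[OF assms] by simp

lemma qpoch_inf_nonzero:
  assumes "norm Q < 1" "norm a < 1"
  shows "qpoch_inf a Q \<noteq> 0"
  unfolding qpoch_inf_def using convergent_prod_qpoch_inf one_minus_mult_power_nonzero assms
  by (intro prodinf_nonzero) auto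

lemma qpoch_0 [simp]: "qpoch a Q 0 = 1"
  by (simp add: qpoch_def)

lemma qpoch_Suc: "qpoch a Q (Suc n) = qpoch a Q n * (1 - a * Q ^ n)"
  by (simp add: qpoch_def)

lemma qpoch_add: "qpoch a Q (m + n) = qpoch a Q m * qpoch (a * Q ^ m) Q n"
  by (induction n) (simp_all add: qpoch_Suc power_add mult_ac)

lemma qpoch_Suc_left: "qpoch a Q (Suc n) = (1 - a) * qpoch (a * Q) Q n"
  using qpoch_add[of a Q 1 n] by (simp add: qpoch_Suc)

lemma qpoch_tendsto:
  assumes "norm Q < 1"
  shows "qpoch a Q \<longlonglongrightarrow> qpoch_inf a Q"
proof -
  have "(\<lambda>n. qpoch a Q (Suc n)) \<longlonglongrightarrow> qpoch_inf a Q"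
    using convergent_prod_LIMSEQ[OF convergent_prod_qpoch_inf[OF assms, of a]]
    by (simp add: qpoch_def qpoch_inf_def lessThan_Suc_atMost)
  then show ?thesis by (simp add: filterlim_sequentially_Suc)
qed

lemma qpoch_inf_shift:
  assumes "norm Q < 1"
  shows "qpoch a Q m * qpoch_inf (a * Q ^ m) Q = qpoch_inf a Q"
proof (rule LIMSEQ_unique)
  show "(\<lambda>n. qpoch a Q (n + m)) \<longlonglongrightarrow> qpoch_inf a Q"
    using qpoch_tendsto[OF assms] by (rule LIMSEQ_ignore_initial_segment)
  have "(\<lambda>n. qpoch a Q m * qpoch (a * Q ^ m) Q n) \<longlonglongrightarrow> qpoch a Q m * qpoch_inf (a * Q ^ m) Q"
    by (intro tendsto_intros qpoch_tendsto assms)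
  then show "(\<lambda>n. qpoch a Q (n + m)) \<longlonglongrightarrow> qpoch a Q m * qpoch_inf (a * Q ^ m) Q"
    by (simp add: qpoch_add add.commute[of _ m])
qed

lemma qpoch_bounded:
  assumes "norm Q < 1"
  obtains K where "K > 0" "\<And>n. norm (qpoch a Q n) \<le> K"
proof -
  have "Bseq (qpoch a Q)"
    using qpoch_tendsto[OF assms] convergent_imp_Bseq convergentI by blast
  then show ?thesis using that by (auto elim: BseqE)
qed

text \<open>For \<open>norm a < 1\<close> the limit \<open>qpoch_inf a Q\<close> is nonzero, so the
  reciprocals converge too.\<close>

lemma inverse_qpoch_bounded:
  assumes "norm Q < 1" "norm a < 1"
  obtains K where "K > 0" "\<And>n. norm (inverse (qpoch a Q n)) \<le> K"
proof -
  have "(\<lambda>n. inverse (qpoch a Q n)) \<longlonglongrightarrow> inverse (qpoch_inf a Q)"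
    using assms by (intro tendsto_intros qpoch_tendsto qpoch_inf_nonzero)
  then have "Bseq (\<lambda>n. inverse (qpoch a Q n))"
    using convergent_imp_Bseq convergentI by blast
  then show ?thesis using that by (auto elim: BseqE)
qed

subsection \<open>Summation of a confluent hypergeometric series\<close>

text \<open>The ratio of consecutive terms is \<open>y * p ^ n\<close>, which tends to 0 however
  large \<open>y\<close> is.\<close>

lemma summable_power_choose_two:
  fixes y p :: real
  assumes "0 \<le> y" "0 \<le> p" "p < 1"
  shows "summable (\<lambda>n. y ^ n * p ^ (n choose 2))"
proof -
  have "(\<lambda>n. y * p ^ n) \<longlonglongrightarrow> y * 0"
    using assms by (intro tendsto_intros LIMSEQ_realpow_zero) auto
  then have "eventually (\<lambda>n. y * p ^ n < 1/2) sequentially"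
    by (rule order_tendstoD) simp
  then obtain N where N: "\<And>n. n \<ge> N \<Longrightarrow> y * p ^ n < 1/2"
    by (auto simp: eventually_sequentially)
  show ?thesis
  proof (rule summable_ratio_test)
    fix n assume "n \<ge> N"
    have "Suc n choose 2 = n + (n choose 2)"
      by (simp add: numeral_2_eq_2)
    then have "norm (y ^ Suc n * p ^ (Suc n choose 2)) = (y * p ^ n) * norm (y ^ n * p ^ (n choose 2))"
      using assms by (simp add: power_add)
    also have "\<dots> \<le> 1/2 * norm (y ^ n * p ^ (n choose 2))"
      using N[OF \<open>n \<ge> N\<close>] by (intro mult_right_mono) auto
    finally show "norm (y ^ Suc n * p ^ (Suc n choose 2)) \<le> 1/2 * norm (y ^ n * p ^ (n choose 2))" .
  qed simp
qed

lemma summable_power_square: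
  fixes y p :: real
  assumes "0 \<le> y" "0 \<le> p" "p < 1"
  shows "summable (\<lambda>n. y ^ n * p ^ (n\<^sup>2))"
proof (rule summable_comparison_test'[OF summable_power_choose_two[OF assms]])
  fix n :: nat
  have "n choose 2 \<le> n\<^sup>2"
    by (simp add: choose_two power2_eq_square algebra_simps)
  then show "norm (y ^ n * p ^ (n\<^sup>2)) \<le> y ^ n * p ^ (n choose 2)"
    using assms by (auto intro!: mult_left_mono power_decreasing)
qed

text \<open>Summand of the basic hypergeometric series 1phi1(a; c; Q, c/a) with c = ab; taking
  \<open>b\<close> as parameter avoids a division by \<open>a\<close>.\<close>

definition phi11_term :: "complex \<Rightarrow> complex \<Rightarrow> complex \<Rightarrow> nat \<Rightarrow> complex" where
  "phi11_term a b Q m =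
     qpoch a Q m / (qpoch Q Q m * qpoch (a * b) Q m) * (- b) ^ m * Q ^ (m choose 2)"

text \<open>One \<open>K\<close> serves all \<open>n\<close>, so the bound dominates the series
  while \<open>n\<close> grows; its case \<open>n = 0\<close> gives absolute convergence.\<close>

lemma phi11_term_bounded:
  assumes "norm Q < 1" "norm (a * b) < 1"
  obtains K where
    "\<And>n m. norm (phi11_term a (b * Q ^ n) Q m) \<le> K * (norm b ^ m * norm Q ^ (m choose 2))"
proof -
  obtain A where A: "A > 0" "\<And>n. norm (qpoch a Q n) \<le> A"
    using qpoch_bounded assms by blast
  obtain B where B: "B > 0" "\<And>n. norm (inverse (qpoch Q Q n)) \<le> B"
    using inverse_qpoch_bounded assms by blast
  obtain C where C: "C > 0" "\<And>n. norm (inverse (qpoch (a * b) Q n)) \<le> C"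
    using inverse_qpoch_bounded assms by blast
  obtain D where D: "D > 0" "\<And>n. norm (qpoch (a * b) Q n) \<le> D"
    using qpoch_bounded assms by blast
  show ?thesis
  proof (rule that)
    fix n m
    \<comment> \<open>As a quotient of two unshifted symbols, the reciprocal is bounded uniformly in
      \<open>n\<close> and \<open>m\<close>.\<close>
    have "inverse (qpoch (a * b * Q ^ n) Q m) = qpoch (a * b) Q n * inverse (qpoch (a * b) Q (n + m))"
      unfolding qpoch_add using qpoch_nonzero[OF assms] by simp
    then have *: "phi11_term a (b * Q ^ n) Q m =
      (qpoch a Q m * inverse (qpoch Q Q m) * (qpoch (a * b) Q n * inverse (qpoch (a * b) Q (n + m))))
      * ((- (b * Q ^ n)) ^ m * Q ^ (m choose 2))"
      unfolding phi11_term_def by (simp add: divide_inverse mult_ac)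
    have "norm (b * Q ^ n) \<le> norm b * 1"
      unfolding norm_mult norm_power using assms by (intro mult_left_mono power_le_one) auto
    then have "norm ((- (b * Q ^ n)) ^ m) \<le> norm b ^ m"
      unfolding norm_power norm_minus_cancel by (intro power_mono) auto
    then show "norm (phi11_term a (b * Q ^ n) Q m) \<le> (A * B * (D * C)) * (norm b ^ m * norm Q ^ (m choose 2))"
      unfolding * norm_mult norm_power[of Q] using A B C D
      by (intro mult_mono) (auto intro!: mult_nonneg_nonneg simp: less_imp_le)
  qed
qed

lemma phi11_term_summable_norm:
  assumes "norm Q < 1" "norm (a * b) < 1"
  shows "summable (\<lambda>m. norm (phi11_term a b Q m))"
proof -
  obtain K where K: "\<And>n m. norm (phi11_term a (b * Q ^ n) Q m) \<le> K * (norm b ^ m * norm Q ^ (m choose 2))"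
    using phi11_term_bounded assms by blast
  have "summable (\<lambda>m. K * (norm b ^ m * norm Q ^ (m choose 2)))"
    using assms by (intro summable_mult summable_power_choose_two) auto
  then show ?thesis
    using K[of 0] by (elim summable_comparison_test') auto
qed

lemma phi11_contiguous:
  assumes Q: "norm Q < 1" and ab: "norm (a * b) < 1"
  shows "(1 - a * b) * (\<Sum>m. phi11_term a b Q m) = (1 - b) * (\<Sum>m. phi11_term a (b * Q) Q m)"
proof -
  define t where "t = phi11_term a b Q"
  define s where "s = phi11_term a (b * Q) Q"
  have "norm (a * (b * Q)) \<le> norm (a * b) * 1"
    unfolding mult.assoc[symmetric] norm_mult[of _ Q] using Q by (intro mult_left_mono) auto
  then have abQ: "norm (a * (b * Q)) < 1" using ab by simp
  \<comment> \<open>a WZ certificate: the difference of the two summands telescopes through \<open>G\<close>\<close>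
  define G where "G m = - (1 - Q ^ m) * (1 - a * b) * t m" for m
  have t: "summable t" and s: "summable s"
    unfolding t_def s_def using phi11_term_summable_norm Q ab abQ summable_norm_cancel by blast+
  have G0: "G \<longlonglongrightarrow> - (1 - 0) * (1 - a * b) * 0"
    unfolding G_def using Q t
    by (intro tendsto_intros LIMSEQ_power_zero summable_LIMSEQ_zero) auto
  have "(1 - a * b) * t m - (1 - b) * s m = G (Suc m) - G m" for m
  proof -
    \<comment> \<open>\<open>(1 - a * b) * t m\<close>, \<open>s m\<close>, \<open>G m\<close> and
      \<open>G (Suc m)\<close> are all \<open>A\<close> times a polynomial in \<open>Q ^ m\<close>,
      which leaves a polynomial identity.\<close>
    define A where "A = qpoch a Q m / (qpoch Q Q m * qpoch (a * b * Q) Q m) * (- b) ^ m * Q ^ (m choose 2)"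
    have nz: "1 - a * b \<noteq> 0" "qpoch (a * b) Q m \<noteq> 0" "qpoch Q Q m \<noteq> 0" "1 - a * b * Q ^ m \<noteq> 0"
        "1 - Q * Q ^ m \<noteq> 0"
      using one_minus_mult_power_nonzero[OF Q ab, of 0] one_minus_mult_power_nonzero[OF Q ab, of m]
        one_minus_mult_power_nonzero[OF Q Q, of m] qpoch_nonzero[OF Q ab] qpoch_nonzero[OF Q Q] by auto
    have shift: "(1 - a * b) * qpoch (a * b * Q) Q m = qpoch (a * b) Q m * (1 - a * b * Q ^ m)"
      using qpoch_Suc_left qpoch_Suc by metis
    then have shift': "qpoch (a * b * Q) Q m = qpoch (a * b) Q m * (1 - a * b * Q ^ m) / (1 - a * b)"
      using nz by (simp add: field_simps)
    have 1: "(1 - a * b) * t m = A * (1 - a * b * Q ^ m)"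
      unfolding t_def phi11_term_def A_def shift' using nz by simp
    have 2: "s m = A * Q ^ m"
      unfolding s_def phi11_term_def A_def minus_mult_left power_mult_distrib by (simp add: mult_ac)
    have "Suc m choose 2 = m + (m choose 2)"
      by (simp add: numeral_2_eq_2)
    then have 3: "(1 - Q ^ Suc m) * ((1 - a * b) * t (Suc m)) = - b * Q ^ m * (1 - a * Q ^ m) * A"
      unfolding t_def phi11_term_def A_def shift' qpoch_Suc using nz
      by (simp add: power_add mult_ac)
    have "G (Suc m) = - ((1 - Q ^ Suc m) * ((1 - a * b) * t (Suc m)))"
        "G m = - (1 - Q ^ m) * ((1 - a * b) * t m)"
      by (simp_all add: G_def algebra_simps)
    then show ?thesis
      unfolding 1 2 3 by simp (simp add: algebra_simps)
  qed
  \<comment> \<open>The total is 0: \<open>G 0\<close> contains the factor \<open>1 - Q ^ 0\<close>,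
    and \<open>G\<close> tends to 0 together with \<open>t\<close>.\<close>
  moreover have "(\<lambda>m. G (Suc m) - G m) sums (0 - G 0)"
    using G0 by (intro telescope_sums) simp
  ultimately have "(\<lambda>m. (1 - a * b) * t m - (1 - b) * s m) sums 0"
    by (simp add: G_def)
  moreover have "(\<lambda>m. (1 - a * b) * t m - (1 - b) * s m) sums ((1 - a * b) * suminf t - (1 - b) * suminf s)"
    using t s by (intro sums_diff sums_mult summable_sums)
  ultimately show ?thesis
    using sums_unique2 unfolding t_def s_def by force
qed

lemma phi11_sum:
  assumes Q: "norm Q < 1" and ab: "norm (a * b) < 1"
  shows "phi11_term a b Q sums (qpoch_inf b Q / qpoch_inf (a * b) Q)"
proof -
  define F where "F n = (\<Sum>m. phi11_term a (b * Q ^ n) Q m)" for n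
  have iter: "qpoch (a * b) Q n * F 0 = qpoch b Q n * F n" for n
  proof (induction n)
    case (Suc n)
    have "norm (a * b * Q ^ n) \<le> norm (a * b) * 1"
      unfolding norm_mult[of "a * b"] norm_power using Q by (intro mult_left_mono power_le_one) auto
    then have "norm (a * (b * Q ^ n)) < 1" using ab by (simp add: mult_ac)
    from phi11_contiguous[OF Q this]
    have *: "(1 - a * b * Q ^ n) * F n = (1 - b * Q ^ n) * F (Suc n)"
      by (simp add: F_def mult_ac)
    have "qpoch (a * b) Q (Suc n) * F 0 = (qpoch (a * b) Q n * F 0) * (1 - a * b * Q ^ n)"
      by (simp add: qpoch_Suc mult_ac)
    also have "\<dots> = qpoch b Q n * ((1 - a * b * Q ^ n) * F n)"
      unfolding Suc.IH by (simp add: mult_ac)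
    also have "\<dots> = qpoch b Q (Suc n) * F (Suc n)"
      unfolding * by (simp add: qpoch_Suc mult_ac)
    finally show ?case .
  qed simp
  obtain K where K: "\<And>n m. norm (phi11_term a (b * Q ^ n) Q m) \<le> K * (norm b ^ m * norm Q ^ (m choose 2))"
    using phi11_term_bounded[OF Q ab] by blast
  \<comment> \<open>Since \<open>b * Q ^ n\<close> tends to 0, each term with \<open>m > 0\<close>
    dies out; the uniform bound lets the limit pass inside the sum.\<close>
  have "F \<longlonglongrightarrow> (\<Sum>m. if m = 0 then 1 else 0)"
    unfolding F_def
  proof (rule tannerys_theorem[THEN conjunct2, THEN conjunct2])
    show "summable (\<lambda>m. K * (norm b ^ m * norm Q ^ (m choose 2)))"
      using Q by (intro summable_mult summable_power_choose_two) auto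
    show "\<forall>\<^sub>F (k, n) in sequentially \<times>\<^sub>F sequentially.
         norm (phi11_term a (b * Q ^ n) Q k) \<le> K * (norm b ^ k * norm Q ^ (k choose 2))"
      using K by (intro always_eventually) auto
    fix m
    have "(\<lambda>n. qpoch (a * (b * Q ^ n)) Q m) \<longlonglongrightarrow> (\<Prod>k<m. 1 - a * (b * 0) * Q ^ k)"
      unfolding qpoch_def using Q by (intro tendsto_intros LIMSEQ_power_zero)
    then have "(\<lambda>n. phi11_term a (b * Q ^ n) Q m) \<longlonglongrightarrow>
      qpoch a Q m / (qpoch Q Q m * (\<Prod>k<m. 1 - a * (b * 0) * Q ^ k)) * (- (b * 0)) ^ m * Q ^ (m choose 2)"
      unfolding phi11_term_def using Q qpoch_nonzero[OF Q Q]
      by (intro tendsto_intros LIMSEQ_power_zero) auto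
    then show "(\<lambda>n. phi11_term a (b * Q ^ n) Q m) \<longlonglongrightarrow> (if m = 0 then 1 else 0)"
      by (cases m) (simp_all add: numeral_2_eq_2)
  qed auto
  moreover have "(\<Sum>m. if m = 0 then 1 else 0) = (1 :: complex)"
    using sums_unique[OF sums_single[of 0 "\<lambda>_. 1 :: complex"]] by simp
  ultimately have "(\<lambda>n. qpoch b Q n * F n) \<longlonglongrightarrow> qpoch_inf b Q * 1"
    by (intro tendsto_mult qpoch_tendsto Q) simp
  moreover have "(\<lambda>n. qpoch (a * b) Q n * F 0) \<longlonglongrightarrow> qpoch_inf (a * b) Q * F 0"
    by (intro tendsto_intros qpoch_tendsto Q)
  ultimately have "qpoch_inf (a * b) Q * F 0 = qpoch_inf b Q"
    using LIMSEQ_unique by (simp add: iter)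
  then have "F 0 = qpoch_inf b Q / qpoch_inf (a * b) Q"
    using qpoch_inf_nonzero[OF Q ab] by (simp add: field_simps)
  moreover have "phi11_term a b Q sums F 0"
    using phi11_term_summable_norm[OF Q ab] summable_norm_cancel by (auto simp: F_def intro: summable_sums)
  ultimately show ?thesis by simp
qed

subsection \<open>The finite triple product in Chebyshev form\<close>

text \<open>The value \<open>0\<close> at negative arguments makes the recurrence below hold for every integer.\<close>

definition inv_qfact :: "complex \<Rightarrow> int \<Rightarrow> complex" where
  "inv_qfact Q k = (if k < 0 then 0 else inverse (qpoch Q Q (nat k)))"

text \<open>At \<open>k = 0\<close> the factor \<open>1 - Q powi 0\<close> vanishes, matching the
  default value on the left; for \<open>k < 0\<close> both sides are default values.\<close>

lemma inv_qfact_pred: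
  assumes "norm Q < 1"
  shows "inv_qfact Q (k - 1) = (1 - Q powi k) * inv_qfact Q k"
proof (cases "k > 0")
  case True
  then obtain m where k: "k = int (Suc m)"
    using zero_less_imp_eq_int by (metis Suc_pred')
  then have "nat (k - 1) = m" "nat k = Suc m" by auto
  moreover have "Q powi k = Q * Q ^ m"
    unfolding k power_int_of_nat by simp
  ultimately show ?thesis
    using True one_minus_mult_power_nonzero[OF assms assms, of m]
    by (simp add: inv_qfact_def qpoch_Suc)
qed (auto simp: inv_qfact_def)

text \<open>This is q^(j^2) times the Gaussian binomial coefficient of 2n over n + j in base q^2,
  already divided by (q^2;q^2)_(2n).\<close>

definition triple_coeff :: "complex \<Rightarrow> nat \<Rightarrow> int \<Rightarrow> complex" where
  "triple_coeff q n j = q powi (j\<^sup>2) * inv_qfact (q\<^sup>2) (int n - j) * inv_qfact (q\<^sup>2) (int n + j)"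

lemma triple_coeff_eq_0: "int n < \<bar>j\<bar> \<Longrightarrow> triple_coeff q n j = 0"
  by (auto simp: triple_coeff_def inv_qfact_def)

text \<open>Comparison of the coefficients of \<open>z\<^sup>j\<close> when the factor
  \<open>(1 + z q\<^bsup>2 n + 1\<^esup>) (1 + q\<^bsup>2 n + 1\<^esup> / z)\<close> is multiplied in.\<close>

lemma triple_coeff_Suc:
  fixes q :: complex
  assumes q: "norm q < 1" "q \<noteq> 0"
  shows "(1 - (q\<^sup>2) ^ (2 * n + 1)) * (1 - (q\<^sup>2) ^ (2 * n + 2)) * triple_coeff q (Suc n) j =
    (1 + q ^ (4 * n + 2)) * triple_coeff q n j
    + q ^ (2 * n + 1) * (triple_coeff q n (j - 1) + triple_coeff q n (j + 1))"
proof -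
  define Q where "Q = q\<^sup>2"
  have Q: "norm Q < 1" "Q \<noteq> 0"
    using q by (auto simp: Q_def norm_power power_less_one_iff)
  have Qpowi: "Q powi k = q powi (2 * k)" for k
    by (simp add: Q_def power_int_mult)
  \<comment> \<open>Every inverse factorial in the recurrence is \<open>A\<close> or
    \<open>B\<close>, those of highest index, times factors in \<alpha>, \<beta> and
    \<open>Q\<close>.\<close>
  define \<alpha> \<beta> where "\<alpha> = Q powi (int n + 1 - j)" and "\<beta> = Q powi (int n + 1 + j)"
  define A B where "A = inv_qfact Q (int n + 1 - j)" and "B = inv_qfact Q (int n + 1 + j)"
  have A1: "inv_qfact Q (int n - j) = (1 - \<alpha>) * A"
    using inv_qfact_pred[OF Q(1), of "int n + 1 - j"] by (simp add: A_def \<alpha>_def)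
  have B1: "inv_qfact Q (int n + j) = (1 - \<beta>) * B"
    using inv_qfact_pred[OF Q(1), of "int n + 1 + j"] by (simp add: B_def \<beta>_def)
  have "Q powi (int n - j) = \<alpha> / Q"
    using power_int_diff[of Q "int n + 1 - j" 1] Q by (simp add: \<alpha>_def)
  then have A2: "inv_qfact Q (int n - (j + 1)) = (1 - \<alpha> / Q) * ((1 - \<alpha>) * A)"
    using inv_qfact_pred[OF Q(1), of "int n - j"] A1 by (simp add: diff_diff_eq)
  have "Q powi (int n + j) = \<beta> / Q"
    using power_int_diff[of Q "int n + 1 + j" 1] Q by (simp add: \<beta>_def)
  then have B2: "inv_qfact Q (int n + (j - 1)) = (1 - \<beta> / Q) * ((1 - \<beta>) * B)"
    using inv_qfact_pred[OF Q(1), of "int n + j"] B1 by (simp add: add_diff_eq)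
  have A3: "inv_qfact Q (int n - (j - 1)) = A" and B3: "inv_qfact Q (int n + (j + 1)) = B"
    by (simp_all add: A_def B_def algebra_simps)
  have AS: "inv_qfact Q (int (Suc n) - j) = A" and BS: "inv_qfact Q (int (Suc n) + j) = B"
    by (simp_all add: A_def B_def algebra_simps)
  have \<alpha>\<beta>: "\<alpha> * \<beta> = Q ^ (2 * n + 2)"
    unfolding \<alpha>_def \<beta>_def power_int_of_nat[symmetric] using Q by (simp add: algebra_simps flip: power_int_add)
  then have \<alpha>\<beta>': "Q ^ (2 * n + 1) = \<alpha> * \<beta> / Q"
    using Q by simp
  have q4: "q ^ (4 * n + 2) = \<alpha> * \<beta> / Q"
    unfolding \<alpha>\<beta>'[symmetric] unfolding Q_def power_mult[symmetric] by (rule arg_cong[of _ _ "power q"]) simp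
  have sq1: "q ^ (2 * n + 1) * q powi ((j - 1)\<^sup>2) = q powi (j\<^sup>2) * \<alpha>"
  proof -
    have "int (2 * n + 1) + (j - 1)\<^sup>2 = j\<^sup>2 + 2 * (int n + 1 - j)"
      by (simp add: power2_eq_square algebra_simps)
    then show ?thesis
      unfolding \<alpha>_def Qpowi power_int_of_nat[symmetric] power_int_add[OF disjI1[OF q(2)], symmetric] by (rule arg_cong)
  qed
  have sq2: "q ^ (2 * n + 1) * q powi ((j + 1)\<^sup>2) = q powi (j\<^sup>2) * \<beta>"
  proof -
    have "int (2 * n + 1) + (j + 1)\<^sup>2 = j\<^sup>2 + 2 * (int n + 1 + j)"
      by (simp add: power2_eq_square algebra_simps)
    then show ?thesis
      unfolding \<beta>_def Qpowi power_int_of_nat[symmetric] power_int_add[OF disjI1[OF q(2)], symmetric] by (rule arg_cong)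
  qed
  \<comment> \<open>This is what remains of the recurrence once the common factor \<open>X\<close>
    below is taken out.\<close>
  have poly: "(1 - \<alpha> * \<beta> / Q) * (1 - \<alpha> * \<beta>) = (1 + \<alpha> * \<beta> / Q) * ((1 - \<alpha>) * (1 - \<beta>))
      + \<alpha> * ((1 - \<beta> / Q) * (1 - \<beta>)) + \<beta> * ((1 - \<alpha> / Q) * (1 - \<alpha>))"
    using Q(2) by (simp add: field_simps)
  define X where "X = q powi (j\<^sup>2) * A * B"
  have "(1 + q ^ (4 * n + 2)) * triple_coeff q n j = X * ((1 + \<alpha> * \<beta> / Q) * ((1 - \<alpha>) * (1 - \<beta>)))"
    unfolding triple_coeff_def Q_def[symmetric] A1 B1 q4 by (simp add: X_def mult_ac)
  moreover have "q ^ (2 * n + 1) * triple_coeff q n (j - 1)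
      = (q ^ (2 * n + 1) * q powi ((j - 1)\<^sup>2)) * (A * ((1 - \<beta> / Q) * ((1 - \<beta>) * B)))"
    unfolding triple_coeff_def Q_def[symmetric] A3 B2 by (simp add: mult_ac)
  then have "q ^ (2 * n + 1) * triple_coeff q n (j - 1) = X * (\<alpha> * ((1 - \<beta> / Q) * (1 - \<beta>)))"
    unfolding sq1 by (simp add: X_def mult_ac)
  moreover have "q ^ (2 * n + 1) * triple_coeff q n (j + 1)
      = (q ^ (2 * n + 1) * q powi ((j + 1)\<^sup>2)) * ((1 - \<alpha> / Q) * ((1 - \<alpha>) * A) * B)"
    unfolding triple_coeff_def Q_def[symmetric] A2 B3 by (simp add: mult_ac)
  then have "q ^ (2 * n + 1) * triple_coeff q n (j + 1) = X * (\<beta> * ((1 - \<alpha> / Q) * (1 - \<alpha>)))"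
    unfolding sq2 by (simp add: X_def mult_ac)
  ultimately have "(1 + q ^ (4 * n + 2)) * triple_coeff q n j
    + q ^ (2 * n + 1) * (triple_coeff q n (j - 1) + triple_coeff q n (j + 1))
    = X * ((1 - \<alpha> * \<beta> / Q) * (1 - \<alpha> * \<beta>))"
    unfolding poly by (simp only: distrib_left add.assoc)
  then show ?thesis
    unfolding triple_coeff_def[of q "Suc n"] Q_def[symmetric] AS BS \<alpha>\<beta>' \<alpha>\<beta>[symmetric]
    by (simp add: X_def mult_ac)
qed

section \<open>Chebyshev polynomials: growth, even extension and folding\<close>

definition chebVsum :: "nat \<Rightarrow> complex \<Rightarrow> complex" where
  "chebVsum n x = chebV (int n) x + chebV (int n - 1) x"

lemma chebVsum_0: "chebVsum 0 x = 1"
  by (simp add: chebVsum_def chebV_def)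

lemma chebVsum_Suc: "chebVsum (Suc n) x = chebV_nat (Suc n) x + chebV_nat n x"
  by (simp add: chebVsum_def chebV_def nat_add_distrib)

text \<open>With \<open>M = 2 * norm x + 1\<close>, which is at least 1, the recurrence yields at
  most \<open>(M - 1) * M ^ Suc n + M ^ n\<close>. Geometric growth suffices against the factor
  \<open>norm q ^ (j\<^sup>2)\<close>.\<close>

lemma norm_chebV_nat_le: "norm (chebV_nat n x) \<le> (2 * norm x + 1) ^ n"
proof (induction n x rule: chebV_nat.induct)
  case (2 x)
  show ?case using norm_triangle_ineq4[of "2 * x" 1] by (simp add: norm_mult)
next
  case (3 n x)
  define M where "M = 2 * norm x + 1"
  have "norm (chebV_nat (Suc (Suc n)) x) \<le> norm (2 * x * chebV_nat (Suc n) x) + norm (chebV_nat n x)"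
    by (simp add: norm_triangle_ineq4)
  also have "\<dots> \<le> (M - 1) * M ^ Suc n + M ^ Suc n"
  proof (intro add_mono)
    show "norm (2 * x * chebV_nat (Suc n) x) \<le> (M - 1) * M ^ Suc n"
      using 3(1) by (auto simp: M_def norm_mult intro!: mult_mono)
    have "M ^ n \<le> M ^ Suc n"
      by (intro power_increasing) (auto simp: M_def)
    then show "norm (chebV_nat n x) \<le> M ^ Suc n"
      using 3(2) by (simp add: M_def)
  qed
  also have "\<dots> = M ^ Suc (Suc n)" by (simp add: algebra_simps)
  finally show ?case by (simp add: M_def)
qed auto

lemma norm_chebVsum_le: "norm (chebVsum n x) \<le> 2 * (2 * norm x + 1) ^ n"
proof (cases n)
  case (Suc m)
  have "(2 * norm x + 1) ^ m \<le> (2 * norm x + 1) ^ Suc m"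
    by (intro power_increasing) auto
  then show ?thesis
    using norm_triangle_ineq[of "chebV_nat (Suc m) x" "chebV_nat m x"]
      norm_chebV_nat_le[of m x] norm_chebV_nat_le[of "Suc m" x]
    unfolding Suc chebVsum_Suc by linarith
qed (simp add: chebVsum_0)

text \<open>Chebyshev polynomials of the first kind, extended evenly to negative indices.\<close>

definition chebT :: "int \<Rightarrow> complex \<Rightarrow> complex" where
  "chebT j x = (if j = 0 then 1 else chebVsum (nat \<bar>j\<bar>) x / 2)"

lemma chebT_minus: "chebT (- j) x = chebT j x"
  by (simp add: chebT_def)

text \<open>The recurrence of V passes to sums of neighbours; indices 0 and 1 are checked directly,
  and negative ones follow by evenness. At \<open>j = 0\<close> both neighbours equal
  \<open>x\<close>.\<close>

lemma chebT_three_term: "2 * x * chebT j x = chebT (j + 1) x + chebT (j - 1) x"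
proof -
  have *: "2 * x * chebT (int k) x = chebT (int k + 1) x + chebT (int k - 1) x" for k
  proof -
    consider "k = 0" | "k = 1" | m where "k = Suc (Suc m)"
      by (metis One_nat_def not0_implies_Suc)
    then show ?thesis
    proof cases
      case (3 m)
      have nats: "nat \<bar>int k\<bar> = Suc (Suc m)" "nat \<bar>int k + 1\<bar> = Suc (Suc (Suc m))" "nat \<bar>int k - 1\<bar> = Suc m"
        "int k \<noteq> 0" "int k + 1 \<noteq> 0" "int k - 1 \<noteq> 0"
        using 3 by auto
      show ?thesis
        unfolding chebT_def nats chebVsum_Suc using nats by (simp add: field_simps)
    qed (simp_all add: chebT_def chebVsum_Suc numeral_2_eq_2 field_simps)
  qed
  show ?thesis
  proof (cases "j \<ge> 0")
    case True
    then show ?thesis using *[of "nat j"] by simp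
  next
    case False
    then show ?thesis
      using *[of "nat (- j)"] chebT_minus[of j x] chebT_minus[of "j - 1" x] chebT_minus[of "- j - 1" x]
      by (simp add: algebra_simps)
  qed
qed

text \<open>For \<open>j > 0\<close> the indices \<open>j\<close> and \<open>- j\<close> each
  contribute half of \<open>chebVsum j x\<close>; index 0 occurs once, in agreement with
  \<open>chebVsum 0 x = 1\<close>.\<close>

lemma sum_chebT_fold:
  "(\<Sum>j=-int n..int n. g (nat \<bar>j\<bar>) * chebT j x) = (\<Sum>j\<le>n. g j * chebVsum j x)"
proof (induction n)
  case 0
  then show ?case by (simp add: chebT_def chebVsum_0)
next
  case (Suc n)
  have "{- int (Suc n)..int (Suc n)} = insert (int (Suc n)) (insert (- int (Suc n)) {- int n..int n})"
    by auto
  then have "(\<Sum>j=-int (Suc n)..int (Suc n). g (nat \<bar>j\<bar>) * chebT j x) =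
    g (Suc n) * chebT (int (Suc n)) x + (g (Suc n) * chebT (- int (Suc n)) x +
    (\<Sum>j=-int n..int n. g (nat \<bar>j\<bar>) * chebT j x))"
    by (simp add: nat_add_distrib)
  also have "\<dots> = g (Suc n) * chebVsum (Suc n) x + (\<Sum>j\<le>n. g j * chebVsum j x)"
    unfolding Suc.IH chebT_minus by (simp add: chebT_def nat_add_distrib)
  finally show ?case by (simp add: add.commute)
qed

text \<open>Induction in \<open>x\<close> alone: the three-term relation of \<open>chebT\<close>
  plays the role of multiplication by z + 1/z, and \<open>triple_coeff_Suc\<close> compares
  coefficients.\<close>

lemma finite_triple_product_int:
  fixes q :: complex
  assumes q: "norm q < 1" "q \<noteq> 0"
  shows "(\<Prod>i=1..n. 1 + 2 * x * q ^ (2 * i - 1) + q ^ (4 * i - 2)) / qpoch (q\<^sup>2) (q\<^sup>2) (2 * n)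
    = (\<Sum>j=-int n..int n. triple_coeff q n j * chebT j x)"
proof (induction n)
  case 0
  then show ?case by (simp add: triple_coeff_def inv_qfact_def chebT_def)
next
  case (Suc n)
  have Q: "norm (q\<^sup>2) < 1" using q by (simp add: norm_power power_less_one_iff)
  define I where "I = {- int (Suc n)..int (Suc n)}"
  define S where "S = (\<Sum>j=-int n..int n. triple_coeff q n j * chebT j x)"
  \<comment> \<open>Coefficients with |j| > n vanish, so the sum and both its shifts may run over
    the same range \<open>I\<close>.\<close>
  have S: "S = (\<Sum>j\<in>I. triple_coeff q n j * chebT j x)"
    unfolding S_def I_def by (rule sum.mono_neutral_left) (auto intro!: triple_coeff_eq_0)
  have "(\<Sum>j=-int n..int n. triple_coeff q n j * chebT (j + 1) x)
      = (\<Sum>j=-int n+1..int n+1. triple_coeff q n (j - 1) * chebT j x)"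
    by (rule sum.reindex_bij_witness[of _ "\<lambda>j. j - 1" "\<lambda>j. j + 1"]) auto
  also have "\<dots> = (\<Sum>j\<in>I. triple_coeff q n (j - 1) * chebT j x)"
    unfolding I_def by (rule sum.mono_neutral_left) (auto intro!: triple_coeff_eq_0)
  finally have up: "(\<Sum>j=-int n..int n. triple_coeff q n j * chebT (j + 1) x)
      = (\<Sum>j\<in>I. triple_coeff q n (j - 1) * chebT j x)" .
  have "(\<Sum>j=-int n..int n. triple_coeff q n j * chebT (j - 1) x)
      = (\<Sum>j=-int n-1..int n-1. triple_coeff q n (j + 1) * chebT j x)"
    by (rule sum.reindex_bij_witness[of _ "\<lambda>j. j + 1" "\<lambda>j. j - 1"]) auto
  also have "\<dots> = (\<Sum>j\<in>I. triple_coeff q n (j + 1) * chebT j x)"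
    unfolding I_def by (rule sum.mono_neutral_left) (auto intro!: triple_coeff_eq_0)
  finally have down: "(\<Sum>j=-int n..int n. triple_coeff q n j * chebT (j - 1) x)
      = (\<Sum>j\<in>I. triple_coeff q n (j + 1) * chebT j x)" .
  have "2 * x * S = (\<Sum>j=-int n..int n. triple_coeff q n j * (2 * x * chebT j x))"
    unfolding S_def sum_distrib_left by (simp add: mult_ac)
  also have "\<dots> = (\<Sum>j\<in>I. triple_coeff q n (j - 1) * chebT j x) + (\<Sum>j\<in>I. triple_coeff q n (j + 1) * chebT j x)"
    unfolding chebT_three_term distrib_left sum.distrib up down ..
  finally have xS: "2 * x * S = (\<Sum>j\<in>I. (triple_coeff q n (j - 1) + triple_coeff q n (j + 1)) * chebT j x)"
    by (simp add: sum.distrib distrib_right)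
  define c where "c = (1 - (q\<^sup>2) ^ (2 * n + 1)) * (1 - (q\<^sup>2) ^ (2 * n + 2))"
  have c: "c \<noteq> 0"
    using one_minus_mult_power_nonzero[OF Q Q, of "2 * n"] one_minus_mult_power_nonzero[OF Q Q, of "2 * n + 1"]
    by (simp add: c_def)
  have "c * (\<Sum>j\<in>I. triple_coeff q (Suc n) j * chebT j x)
      = (\<Sum>j\<in>I. ((1 + q ^ (4 * n + 2)) * triple_coeff q n j
    + q ^ (2 * n + 1) * (triple_coeff q n (j - 1) + triple_coeff q n (j + 1))) * chebT j x)"
    unfolding sum_distrib_left mult.assoc[symmetric] c_def triple_coeff_Suc[OF q] ..
  also have "\<dots> = (1 + q ^ (4 * n + 2)) * S + q ^ (2 * n + 1) * (2 * x * S)"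
    unfolding xS unfolding S sum_distrib_left sum.distrib[symmetric] by (simp add: distrib_right mult.assoc)
  also have "\<dots> = (1 + 2 * x * q ^ (2 * n + 1) + q ^ (4 * n + 2)) * S"
    by (simp add: algebra_simps)
  finally have step: "(\<Sum>j\<in>I. triple_coeff q (Suc n) j * chebT j x)
      = (1 + 2 * x * q ^ (2 * n + 1) + q ^ (4 * n + 2)) * S / c"
    using c by (simp add: field_simps)
  have exps: "2 * Suc n - 1 = 2 * n + 1" "4 * Suc n - 2 = 4 * n + 2" "2 * Suc n = Suc (Suc (2 * n))"
    by auto
  have "qpoch (q\<^sup>2) (q\<^sup>2) (2 * Suc n) = qpoch (q\<^sup>2) (q\<^sup>2) (2 * n) * c"
    unfolding exps qpoch_Suc c_def by simp
  then show ?case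
    unfolding I_def[symmetric] step
    unfolding Suc.IH[folded S_def, symmetric] by (simp add: exps(1,2))
qed

lemma finite_triple_product:
  fixes q :: complex
  assumes q: "norm q < 1" "q \<noteq> 0"
  shows "(\<Prod>i=1..n. 1 + 2 * x * q ^ (2 * i - 1) + q ^ (4 * i - 2)) / qpoch (q\<^sup>2) (q\<^sup>2) (2 * n)
    = (\<Sum>j\<le>n. triple_coeff q n (int j) * chebVsum j x)"
proof -
  have "triple_coeff q n (int (nat \<bar>j\<bar>)) = triple_coeff q n j" for j
    by (cases "j \<ge> 0") (auto simp: triple_coeff_def)
  then show ?thesis
    unfolding finite_triple_product_int[OF q] sum_chebT_fold[symmetric] by simp
qed

subsection \<open>Interchange of summation\<close>

text \<open>After \<open>n = m + j\<close> this is the \<open>\<^sub>1\<phi>\<^sub>1\<close> sum with \<open>a = b = - q\<^bsup>2 j + 1\<^esup>\<close> in base \<open>q\<^sup>2\<close>.\<close>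

lemma triple_coeff_sums:
  fixes q :: complex
  assumes q: "norm q < 1"
  shows "(\<lambda>n. q ^ (n\<^sup>2) * qpoch (- q) (q\<^sup>2) n * triple_coeff q n (int j)) sums
    (qpoch_inf (- q) (q\<^sup>2) / qpoch_inf (q\<^sup>2) (q\<^sup>2) * q ^ (2 * j\<^sup>2))"
proof -
  define Q where "Q = q\<^sup>2"
  have Q: "norm Q < 1"
    using q by (auto simp: Q_def norm_power power_less_one_iff)
  \<comment> \<open>One \<open>u\<close> serves both splittings: (-q;Q)_(j+m) leaves the factor
    (u;Q)_m, and (Q;Q)_(2j+m) leaves (u^2;Q)_m.\<close>
  define u where "u = - (q * Q ^ j)"
  have uu: "u * u = Q * Q ^ (2 * j)"
    unfolding u_def Q_def mult_2 power_add by (simp add: power2_eq_square)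
  have "norm (Q * Q ^ (2 * j)) \<le> norm Q * 1"
    unfolding norm_mult norm_power using Q by (intro mult_left_mono power_le_one) auto
  then have nuu: "norm (u * u) < 1" unfolding uu using Q by simp
  define f where "f n = q ^ (n\<^sup>2) * qpoch (- q) Q n * triple_coeff q n (int j)" for n
  have "f (m + j) = q ^ (2 * j\<^sup>2) * (qpoch (- q) Q j / qpoch Q Q (2 * j)) * phi11_term u u Q m" for m
  proof -
    have "(m + j)\<^sup>2 + j\<^sup>2 = 2 * j\<^sup>2 + ((2 * j + 1) * m + 2 * (m choose 2))"
    proof -
      have "2 * (m choose 2) + m = m\<^sup>2"
        by (cases m) (simp_all add: choose_two power2_eq_square)
      then show ?thesis by (simp add: power2_sum algebra_simps)
    qed
    then have "q ^ ((m + j)\<^sup>2) * q ^ (j\<^sup>2) = q ^ (2 * j\<^sup>2) * (q ^ ((2 * j + 1) * m) * q ^ (2 * (m choose 2)))"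
      by (simp only: flip: power_add)
    also have "\<dots> = q ^ (2 * j\<^sup>2) * ((- u) ^ m * Q ^ (m choose 2))"
      by (simp add: u_def Q_def flip: power_mult power_Suc)
    finally have pw: "q ^ ((m + j)\<^sup>2) * q ^ (j\<^sup>2) = q ^ (2 * j\<^sup>2) * ((- u) ^ m * Q ^ (m choose 2))" .
    have "nat (int (m + j) - int j) = m" "nat (int (m + j) + int j) = 2 * j + m" by auto
    then have "triple_coeff q (m + j) (int j) = q ^ (j\<^sup>2) * inverse (qpoch Q Q m) * inverse (qpoch Q Q (2 * j + m))"
      unfolding triple_coeff_def inv_qfact_def Q_def[symmetric] by (simp flip: of_nat_power)
    moreover have "qpoch (- q) Q (m + j) = qpoch (- q) Q j * qpoch u Q m"
      unfolding add.commute[of m] qpoch_add u_def by simp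
    moreover have "qpoch Q Q (2 * j + m) = qpoch Q Q (2 * j) * qpoch (u * u) Q m"
      unfolding qpoch_add uu ..
    ultimately have "f (m + j) = (q ^ ((m + j)\<^sup>2) * q ^ (j\<^sup>2)) * (qpoch (- q) Q j / qpoch Q Q (2 * j))
        * (qpoch u Q m / (qpoch Q Q m * qpoch (u * u) Q m))"
      by (simp add: f_def divide_inverse mult_ac)
    then show ?thesis
      unfolding pw by (simp add: phi11_term_def mult_ac)
  qed
  then have "(\<lambda>m. f (m + j)) sums (q ^ (2 * j\<^sup>2) * (qpoch (- q) Q j / qpoch Q Q (2 * j)) *
      (qpoch_inf u Q / qpoch_inf (u * u) Q))"
    using sums_mult[OF phi11_sum[OF Q nuu]] by presburger
  also have "q ^ (2 * j\<^sup>2) * (qpoch (- q) Q j / qpoch Q Q (2 * j)) * (qpoch_inf u Q / qpoch_inf (u * u) Q)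
    = qpoch_inf (- q) Q / qpoch_inf Q Q * q ^ (2 * j\<^sup>2)"
    unfolding uu qpoch_inf_shift[OF Q, of "- q" j, symmetric] qpoch_inf_shift[OF Q, of Q "2 * j", symmetric]
    by (simp add: u_def)
  finally have "f sums (qpoch_inf (- q) Q / qpoch_inf Q Q * q ^ (2 * j\<^sup>2) + sum f {..<j})"
    by (simp only: sums_iff_shift)
  \<comment> \<open>Terms with \<open>n < j\<close> vanish, so starting at \<open>n = j\<close>
    loses nothing.\<close>
  moreover have "sum f {..<j} = 0"
    by (intro sum.neutral) (auto simp: f_def triple_coeff_eq_0)
  ultimately show ?thesis unfolding Q_def[symmetric] f_def[symmetric] by simp
qed

section \<open>Absolute convergence of the double series\<close>

lemma summable_on_UNIV_times:
  fixes g :: "nat \<Rightarrow> real" and h :: "nat \<Rightarrow> real"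
  assumes "summable g" "summable h" "\<And>n. g n \<ge> 0" "\<And>n. h n \<ge> 0"
  shows "(\<lambda>(n, j). g n * h j) summable_on UNIV \<times> UNIV"
proof (rule summable_on_SigmaI)
  have "h summable_on UNIV"
    using assms by (intro norm_summable_imp_summable_on) simp
  then show "((\<lambda>j. case (n, j) of (n, j) \<Rightarrow> g n * h j) has_sum g n * infsum h UNIV) UNIV" for n
    by (auto intro: has_sum_cmult_right has_sum_infsum)
  show "(\<lambda>n. g n * infsum h UNIV) summable_on UNIV"
    using assms by (intro summable_on_cmult_left norm_summable_imp_summable_on) simp
qed (use assms in auto)

text \<open>All q-factorial factors are bounded and \<open>chebVsum\<close> grows at most
  geometrically, so a product \<open>g n * h j\<close> dominates; the quadratic exponents make both
  factors summable.\<close>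

lemma triple_coeff_double_summable:
  fixes q x :: complex
  assumes q: "norm q < 1"
  shows "(\<lambda>(n, j). q ^ (n\<^sup>2) * qpoch (- q) (q\<^sup>2) n * (triple_coeff q n (int j) * chebVsum j x))
    summable_on UNIV \<times> UNIV"
proof -
  have Q: "norm (q\<^sup>2) < 1"
    using q by (simp add: norm_power power_less_one_iff)
  define M where "M = 2 * norm x + 1"
  obtain A where A: "A > 0" "\<And>n. norm (qpoch (- q) (q\<^sup>2) n) \<le> A"
    using qpoch_bounded Q by blast
  obtain B where B: "B > 0" "\<And>n. norm (inverse (qpoch (q\<^sup>2) (q\<^sup>2) n)) \<le> B"
    using inverse_qpoch_bounded Q by blast
  have B': "norm (inv_qfact (q\<^sup>2) k) \<le> B" for k
    using B by (simp add: inv_qfact_def less_imp_le)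
  define g where "g n = A * norm q ^ (n\<^sup>2)" for n :: nat
  define h where "h j = B * B * 2 * (M ^ j * norm q ^ (j\<^sup>2))" for j :: nat
  have M: "M \<ge> 0" by (simp add: M_def)
  have "(\<lambda>(n, j). g n * h j) summable_on UNIV \<times> UNIV"
  proof (rule summable_on_UNIV_times)
    show "summable g"
      unfolding g_def using summable_power_square[of 1 "norm q"] q by (intro summable_mult) auto
    show "summable h"
      unfolding h_def using q M by (intro summable_mult summable_power_square) auto
  qed (use A B M in \<open>auto simp: g_def h_def\<close>)
  then have "(\<lambda>p. norm (case p of (n, j) \<Rightarrow> q ^ (n\<^sup>2) * qpoch (- q) (q\<^sup>2) n *
      (triple_coeff q n (int j) * chebVsum j x))) summable_on UNIV \<times> UNIV"
  proof (rule Infinite_Sum.abs_summable_on_comparison_test')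
    fix p :: "nat \<times> nat"
    obtain n j where p: "p = (n, j)" by fastforce
    have "norm (triple_coeff q n (int j)) \<le> norm q ^ (j\<^sup>2) * B * B"
      unfolding triple_coeff_def norm_mult using B B'
      by (intro mult_mono) (auto simp: norm_power less_imp_le simp flip: of_nat_power)
    then have "norm (q ^ (n\<^sup>2) * qpoch (- q) (q\<^sup>2) n * (triple_coeff q n (int j) * chebVsum j x))
      \<le> norm q ^ (n\<^sup>2) * A * ((norm q ^ (j\<^sup>2) * B * B) * (2 * M ^ j))"
      unfolding norm_mult norm_power M_def using A B norm_chebVsum_le[of j x]
      by (intro mult_mono) (auto simp: less_imp_le)
    then show "norm (case p of (n, j) \<Rightarrow> q ^ (n\<^sup>2) * qpoch (- q) (q\<^sup>2) n *
      (triple_coeff q n (int j) * chebVsum j x)) \<le> (case p of (n, j) \<Rightarrow> g n * h j)"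
      by (simp add: p g_def h_def mult_ac)
  qed
  then show ?thesis by (rule abs_summable_summable)
qed

text \<open>The rows of one absolutely summable family add up to \<open>L\<close>, its columns to a
  multiple of \<open>R\<close>. Here \<open>q \<noteq> 0\<close> because the coefficient recurrence
  divides by q^2.\<close>

lemma chebyshev_series_identity_nonzero:
  fixes q x :: complex
  assumes q: "norm q < 1" "q \<noteq> 0"
  defines "L \<equiv> \<lambda>n. q ^ (n\<^sup>2) * qpoch (- q) (q\<^sup>2) n
             * (\<Prod>i=1..n. 1 + 2 * x * q ^ (2 * i - 1) + q ^ (4 * i - 2))
             / qpoch (q\<^sup>2) (q\<^sup>2) (2 * n)"
    and "R \<equiv> \<lambda>n. q ^ (2 * n\<^sup>2) * chebVsum n x"
  shows "summable L \<and> summable R \<and>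
    suminf L = qpoch_inf (- q) (q\<^sup>2) / qpoch_inf (q\<^sup>2) (q\<^sup>2) * suminf R"
proof -
  define c where "c = qpoch_inf (- q) (q\<^sup>2) / qpoch_inf (q\<^sup>2) (q\<^sup>2)"
  have "norm (q\<^sup>2) < 1"
    using q by (simp add: norm_power power_less_one_iff)
  then have c: "c \<noteq> 0"
    using q by (simp add: c_def qpoch_inf_nonzero)
  define f where "f = (\<lambda>(n, j). q ^ (n\<^sup>2) * qpoch (- q) (q\<^sup>2) n * (triple_coeff q n (int j) * chebVsum j x))"
  have f: "f summable_on UNIV \<times> UNIV"
    unfolding f_def by (rule triple_coeff_double_summable[OF q(1)])
  then obtain S where S: "(f has_sum S) (UNIV \<times> UNIV)"
    by (auto simp: summable_on_def)
  have row: "((\<lambda>j. f (n, j)) has_sum L n) UNIV" for n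
  proof (rule has_sum_finite_neutralI[of "{..n}"])
    show "L n = (\<Sum>j\<le>n. f (n, j))"
      unfolding L_def times_divide_eq_right[symmetric] finite_triple_product[OF q] f_def
      by (simp add: sum_distrib_left)
  qed (auto simp: f_def triple_coeff_eq_0)
  have "L sums S"
    using has_sum_SigmaD[OF S row] by (rule has_sum_imp_sums)
  have f': "(\<lambda>(j, n). f (n, j)) summable_on UNIV \<times> UNIV" and S': "((\<lambda>(j, n). f (n, j)) has_sum S) (UNIV \<times> UNIV)"
    using f S summable_on_swap has_sum_swap by blast+
  \<comment> \<open>The closed form is an ordered sum; summability of the column, inherited from the
    double family, makes it unordered.\<close>
  have col: "((\<lambda>n. (\<lambda>(j, n). f (n, j)) (j, n)) has_sum c * R j) UNIV" for j
  proof -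
    have "(\<lambda>n. f (n, j)) sums (c * R j)"
      using sums_mult2[OF triple_coeff_sums[OF q(1), of j], of "chebVsum j x"]
      by (simp add: f_def R_def c_def mult_ac)
    moreover have "(\<lambda>n. f (n, j)) summable_on UNIV"
      using summable_on_SigmaD1[OF f', of j] by simp
    ultimately show ?thesis
      using has_sum_imp_sums sums_unique2 unfolding summable_on_def prod.case by metis
  qed
  have cR: "(\<lambda>j. c * R j) sums S"
    using has_sum_SigmaD[OF S' col] by (rule has_sum_imp_sums)
  \<comment> \<open>Since \<open>c \<noteq> 0\<close>, convergence passes from
    \<open>c * R j\<close> to \<open>R j\<close>.\<close>
  then have "summable R"
    using c summable_cmult_iff[of c R] by (auto simp: sums_iff)
  then have "c * suminf R = S"
    using cR by (simp add: sums_iff suminf_mult)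
  with \<open>L sums S\<close> \<open>summable R\<close> show ?thesis
    by (simp add: sums_iff c_def)
qed

theorem theorem5p1:
  fixes q x :: complex
  assumes "norm q < 1"
  shows "summable (\<lambda>n. q ^ (n\<^sup>2) * qpoch (- q) (q\<^sup>2) n
             * (\<Prod>i=1..n. 1 + 2 * x * q ^ (2 * i - 1) + q ^ (4 * i - 2))
             / qpoch (q\<^sup>2) (q\<^sup>2) (2 * n))
    \<and> summable (\<lambda>n. q ^ (2 * n\<^sup>2) * (chebV (int n) x + chebV (int n - 1) x))
    \<and> (\<Sum>n. q ^ (n\<^sup>2) * qpoch (- q) (q\<^sup>2) n
             * (\<Prod>i=1..n. 1 + 2 * x * q ^ (2 * i - 1) + q ^ (4 * i - 2))
             / qpoch (q\<^sup>2) (q\<^sup>2) (2 * n))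
      = qpoch_inf (- q) (q\<^sup>2) / qpoch_inf (q\<^sup>2) (q\<^sup>2)
        * (\<Sum>n. q ^ (2 * n\<^sup>2) * (chebV (int n) x + chebV (int n - 1) x))"
proof (cases "q = 0")
  case False
  show ?thesis
    using chebyshev_series_identity_nonzero[OF assms False, of x] unfolding chebVsum_def .
next
  case True
  \<comment> \<open>At \<open>q = 0\<close> only the terms with \<open>n = 0\<close> survive, and
    the prefactor is a nonzero number divided by itself.\<close>
  have "(\<lambda>n. q ^ (n\<^sup>2) * qpoch (- q) (q\<^sup>2) n
             * (\<Prod>i=1..n. 1 + 2 * x * q ^ (2 * i - 1) + q ^ (4 * i - 2))
             / qpoch (q\<^sup>2) (q\<^sup>2) (2 * n)) = (\<lambda>n. if n = 0 then 1 else 0)"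
    using True by (auto simp: fun_eq_iff)
  moreover have "(\<lambda>n. q ^ (2 * n\<^sup>2) * (chebV (int n) x + chebV (int n - 1) x)) = (\<lambda>n. if n = 0 then 1 else 0)"
    using True by (auto simp: fun_eq_iff chebV_def)
  moreover have "qpoch_inf (- q) (q\<^sup>2) / qpoch_inf (q\<^sup>2) (q\<^sup>2) = 1"
    using True qpoch_inf_nonzero[of 0 0] by simp
  ultimately show ?thesis
    using summable_single[of 0 "\<lambda>_. 1 :: complex"] by simp
qed

end
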